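(* Let $m\in\mathbb{N}_0$ be even and let $\alpha>0$ be real. Then the function $$P(x)=\left[\beta^{(m)}(x)\right]^{\alpha}$$ is convex for $x>0$.
   Context: Nielsen's $\beta$-function is the function $\beta:(0,\infty)\to\mathbb{R}$ defined by $\beta(x)=\int_0^1 \frac{t^{x-1}}{1+t}\,dt=\int_0^\infty\frac{e^{-xt}}{1+e^{-t}}\,dt$ for $x>0$. For $m\in\mathbb{N}_0=\{0,1,2,\dots\}$, $\beta^{(m)}$ denotes its $m$-th derivative, with $\beta^{(0)}=\beta$. *)

theory Defs
  imports "HOL-Analysis.Analysis"
begin

text \<open>
  Nielsen's beta function. It is of interest for positive \<open>x\<close> only. There the integrand is
  nonnegative and integrable on the unit interval, with a singularity at \<open>0\<close> if \<open>x < 1\<close>;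
  the value at the single point \<open>t = 0\<close> is irrelevant.
\<close>
definition nielsen_beta :: "real \<Rightarrow> real" where
  "nielsen_beta x = integral {0..1} (\<lambda>t. t powr (x - 1) / (1 + t))"

end

theory Submission
  imports Defs
begin

text \<open>
  Write \<open>f\<close> for the \<open>m\<close>-th derivative of \<open>\<beta>\<close>, with \<open>m\<close> even. The function \<open>f\<close> is positive and its
  logarithm is convex, so \<open>f powr \<alpha> = exp (\<alpha> * ln f)\<close> is convex, because \<open>exp\<close> is increasing
  and convex.

  Log-convexity is read off from the series
  \<open>f x = m! * (\<Sum>n. 1 / (x + 2n)^(m+1) - 1 / (x + 2n + 1)^(m+1))\<close>. With \<open>a = 1 / (x + 2n)\<close> and
  \<open>b = 1 / (x + 2n + 1)\<close> one has \<open>a - b = a * b\<close>, so that each summand is a sum of products of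
  powers of the log-convex functions \<open>a\<close> and \<open>b\<close> of \<open>x\<close>
  (\<open>log_convex_on_inverse_power_diff\<close>); and log-convexity survives products, sums and convergent
  series.

  The series comes from a functional equation. A nonnegative function with
  \<open>f x + f (x + 1) = g x\<close>, where \<open>g\<close> tends to \<open>0\<close>, is determined by \<open>g\<close>, as an
  alternating series (\<open>alternating_series_of_functional_equation\<close>). The integral \<open>\<beta>\<close> satisfies this
  with \<open>g x = 1 / x\<close>, and so does half of \<open>Digamma ((x + 1) / 2) - Digamma (x / 2)\<close>; hence the two
  agree. The derivatives of the latter are known in terms of polygamma functions, which avoids
  differentiation under the integral sign, and for even \<open>m\<close> the same functional equation, now with
  \<open>g x = m! / x^(m+1)\<close>, gives the series for them.
\<close>

section \<open>Log-convex functions\<close>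

definition log_convex_on :: "'a::real_vector set \<Rightarrow> ('a \<Rightarrow> real) \<Rightarrow> bool" where
  "log_convex_on S f \<longleftrightarrow> (\<forall>x\<in>S. 0 < f x) \<and> convex_on S (\<lambda>x. ln (f x))"

lemma convex_on_cong:
  assumes "\<And>x. x \<in> S \<Longrightarrow> f x = g x"
  shows "convex_on S f \<longleftrightarrow> convex_on S g"
proof -
  have "convex_on S g" if "convex_on S f" "\<And>x. x \<in> S \<Longrightarrow> f x = g x" for f g
  proof (rule convex_onI)
    show S: "convex S" using that(1) by (rule convex_on_imp_convex)
    fix t :: real and x y
    assume t: "t > 0" "t < 1" and xy: "x \<in> S" "y \<in> S"
    then have "(1 - t) *\<^sub>R x + t *\<^sub>R y \<in> S" using S by (simp add: convexD)
    then show "g ((1 - t) *\<^sub>R x + t *\<^sub>R y) \<le> (1 - t) * g x + t * g y"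
      using convex_onD[OF that(1), of t x y] t xy that(2) by simp
  qed
  from this[of f g] this[of g f] assms show ?thesis by auto
qed

lemma log_convex_on_cong:
  assumes "\<And>x. x \<in> S \<Longrightarrow> f x = g x"
  shows "log_convex_on S f \<longleftrightarrow> log_convex_on S g"
  using assms convex_on_cong[of S "\<lambda>x. ln (f x)" "\<lambda>x. ln (g x)"]
  by (auto simp: log_convex_on_def)

lemma log_convex_on_powr_convex:
  assumes f: "log_convex_on S f" and "\<alpha> \<ge> 0"
  shows "convex_on S (\<lambda>x. f x powr \<alpha>)"
proof (rule convex_onI)
  have ln_f: "convex_on S (\<lambda>x. ln (f x))" using f by (simp add: log_convex_on_def)
  then show "convex S" by (rule convex_on_imp_convex)
  fix t :: real and x y
  assume t: "t > 0" "t < 1" and xy: "x \<in> S" "y \<in> S"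
  let ?z = "(1 - t) *\<^sub>R x + t *\<^sub>R y"
  have z: "?z \<in> S" using convex_on_imp_convex[OF ln_f] t xy by (simp add: convexD)
  have powr: "f w powr \<alpha> = exp (\<alpha> * ln (f w))" if "w \<in> S" for w
    using f that by (force simp: log_convex_on_def powr_def)
  have "convex_on S (\<lambda>x. \<alpha> * ln (f x))"
    using ln_f \<open>\<alpha> \<ge> 0\<close> by (simp add: convex_on_cmul)
  then have "\<alpha> * ln (f ?z) \<le> (1 - t) * (\<alpha> * ln (f x)) + t * (\<alpha> * ln (f y))"
    using t xy by (intro convex_onD) auto
  then have "exp (\<alpha> * ln (f ?z)) \<le> exp ((1 - t) * (\<alpha> * ln (f x)) + t * (\<alpha> * ln (f y)))"
    by simp
  also have "\<dots> \<le> (1 - t) * exp (\<alpha> * ln (f x)) + t * exp (\<alpha> * ln (f y))"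
    using convex_onD[OF exp_convex, of t "\<alpha> * ln (f x)" "\<alpha> * ln (f y)"] t by simp
  finally show "f ?z powr \<alpha> \<le> (1 - t) * f x powr \<alpha> + t * f y powr \<alpha>"
    using powr xy z by simp
qed

lemma log_convex_on_const: "convex S \<Longrightarrow> c > 0 \<Longrightarrow> log_convex_on S (\<lambda>_. c)"
  by (simp add: log_convex_on_def convex_on_const)

lemma log_convex_on_mult:
  assumes "log_convex_on S f" "log_convex_on S g"
  shows "log_convex_on S (\<lambda>x. f x * g x)"
proof -
  have "convex_on S (\<lambda>x. ln (f x) + ln (g x))"
    using assms by (simp add: log_convex_on_def convex_on_add)
  then have "convex_on S (\<lambda>x. ln (f x * g x))"
    using assms by (subst convex_on_cong[of S _ "\<lambda>x. ln (f x) + ln (g x)"])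
      (simp_all add: log_convex_on_def ln_mult_pos)
  then show ?thesis using assms by (simp add: log_convex_on_def)
qed

lemma log_convex_on_power:
  assumes "log_convex_on S f"
  shows "log_convex_on S (\<lambda>x. f x ^ n)"
proof (induction n)
  case 0
  have "convex S" using assms by (auto simp: log_convex_on_def dest: convex_on_imp_convex)
  then show ?case by (simp add: log_convex_on_const)
qed (simp add: log_convex_on_mult assms)

text \<open>
  This is Hoelder's inequality for two summands. At the two end points \<open>f\<close> and \<open>g\<close> are divided by the
  value of the sum there; Young's inequality bounds the normalised geometric means by arithmetic
  means, and these add up to \<open>1\<close>.
\<close>
lemma log_convex_on_add:
  assumes "log_convex_on S f" "log_convex_on S g"
  shows "log_convex_on S (\<lambda>x. f x + g x)"
  unfolding log_convex_on_def
proof (intro conjI ballI convex_onI)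
  have f: "convex_on S (\<lambda>x. ln (f x))" "\<And>x. x \<in> S \<Longrightarrow> 0 < f x"
    and g: "convex_on S (\<lambda>x. ln (g x))" "\<And>x. x \<in> S \<Longrightarrow> 0 < g x"
    using assms by (auto simp: log_convex_on_def)
  show S: "convex S" using f(1) by (rule convex_on_imp_convex)
  show "0 < f x + g x" if "x \<in> S" for x using that f g by (simp add: add_pos_pos)
  fix t :: real and x y
  assume t: "t > 0" "t < 1" and xy: "x \<in> S" "y \<in> S"
  let ?z = "(1 - t) *\<^sub>R x + t *\<^sub>R y"
  have z: "?z \<in> S" using S t xy by (simp add: convexD)
  define A B where "A = f x + g x" and "B = f y + g y"
  have AB: "A > 0" "B > 0" using f g xy by (auto simp: A_def B_def add_pos_pos)
  define M where "M = (1 - t) * ln A + t * ln B"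
  have normalised: "h ?z \<le> exp M * ((1 - t) * (h x / A) + t * (h y / B))"
    if h: "convex_on S (\<lambda>x. ln (h x))" "\<And>x. x \<in> S \<Longrightarrow> 0 < h x" for h :: "'a \<Rightarrow> real"
  proof -
    have pos: "h x > 0" "h y > 0" "h ?z > 0" using h(2) xy z by auto
    have "ln (h ?z) \<le> (1 - t) * ln (h x) + t * ln (h y)"
      using convex_onD[OF h(1), of t x y] t xy by simp
    also have "\<dots> = M + ((1 - t) * ln (h x / A) + t * ln (h y / B))"
      using pos AB by (simp add: M_def ln_div algebra_simps)
    finally have "h ?z \<le> exp (M + ((1 - t) * ln (h x / A) + t * ln (h y / B)))"
      using pos by (metis exp_le_cancel_iff exp_ln)
    also have "\<dots> = exp M * ((h x / A) powr (1 - t) * (h y / B) powr t)"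
      using pos AB by (simp add: powr_def exp_add)
    also have "\<dots> \<le> exp M * ((1 - t) * (h x / A) + t * (h y / B))"
      using pos AB t by (intro mult_left_mono Youngs_inequality_0) auto
    finally show ?thesis .
  qed
  have "f ?z + g ?z \<le> exp M * ((1 - t) * (f x / A) + t * (f y / B))
      + exp M * ((1 - t) * (g x / A) + t * (g y / B))"
    using normalised[OF f] normalised[OF g] by linarith
  also have "\<dots> = exp M * ((1 - t) * ((f x + g x) / A) + t * ((f y + g y) / B))"
    by (simp add: algebra_simps add_divide_distrib)
  also have "\<dots> = exp M" using AB by (simp flip: A_def B_def)
  finally have "ln (f ?z + g ?z) \<le> ln (exp M)"
    using f(2)[OF z] g(2)[OF z] by (subst ln_le_cancel_iff) auto
  then show "ln (f ?z + g ?z) \<le> (1 - t) * ln (f x + g x) + t * ln (f y + g y)"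
    by (simp add: M_def A_def B_def)
qed

lemma log_convex_on_sum:
  assumes "finite I" "I \<noteq> {}" "\<And>i. i \<in> I \<Longrightarrow> log_convex_on S (f i)"
  shows "log_convex_on S (\<lambda>x. \<Sum>i\<in>I. f i x)"
  using assms by (induction rule: finite_ne_induct) (auto intro: log_convex_on_add)

lemma log_convex_on_suminf:
  assumes f: "\<And>n. log_convex_on S (f n)" and sums: "\<And>x. x \<in> S \<Longrightarrow> (\<lambda>n. f n x) sums F x"
  shows "log_convex_on S F"
  unfolding log_convex_on_def
proof (intro conjI ballI convex_onI)
  show S: "convex S" using f by (auto simp: log_convex_on_def dest: convex_on_imp_convex)
  show pos: "0 < F x" if "x \<in> S" for x
    using sums[OF that] f that suminf_pos[of "\<lambda>n. f n x"]
    by (auto simp: log_convex_on_def sums_iff)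
  fix t :: real and x y
  assume t: "t > 0" "t < 1" and xy: "x \<in> S" "y \<in> S"
  let ?z = "(1 - t) *\<^sub>R x + t *\<^sub>R y"
  \<comment> \<open>The empty partial sum is \<open>0\<close> and has no logarithm, hence \<open>Suc n\<close>.\<close>
  let ?s = "\<lambda>n w. \<Sum>k<Suc n. f k w"
  have z: "?z \<in> S" using S t xy by (simp add: convexD)
  have lim: "(\<lambda>n. ln (?s n w)) \<longlonglongrightarrow> ln (F w)" if "w \<in> S" for w
    using sums[OF that] pos[OF that]
    by (intro tendsto_ln LIMSEQ_Suc) (auto simp: sums_def)
  have "log_convex_on S (?s n)" for n by (intro log_convex_on_sum f) auto
  then have "ln (?s n ?z) \<le> (1 - t) * ln (?s n x) + t * ln (?s n y)" for n
    using t xy by (intro convex_onD[where f = "\<lambda>x. ln (?s n x)"]) (auto simp: log_convex_on_def)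
  then show "ln (F ?z) \<le> (1 - t) * ln (F x) + t * ln (F y)"
    by (intro LIMSEQ_le[OF lim[OF z], where Y = "\<lambda>n. (1 - t) * ln (?s n x) + t * ln (?s n y)"]
        tendsto_intros lim xy) blast
qed

lemma log_convex_on_inverse_shift:
  assumes "c \<ge> (0::real)"
  shows "log_convex_on {0<..} (\<lambda>x. inverse (x + c))"
  unfolding log_convex_on_def
proof (intro conjI ballI convex_onI)
  fix t x y :: real
  assume t: "t > 0" "t < 1" and xy: "x \<in> {0<..}" "y \<in> {0<..}"
  have "(1 - t) * ln (x + c) + t * ln (y + c) \<le> ln ((1 - t) *\<^sub>R (x + c) + t *\<^sub>R (y + c))"
    using ln_concave t xy assms by (intro concave_onD) auto
  also have "(1 - t) *\<^sub>R (x + c) + t *\<^sub>R (y + c) = (1 - t) *\<^sub>R x + t *\<^sub>R y + c"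
    by (simp add: algebra_simps)
  finally show "ln (inverse ((1 - t) *\<^sub>R x + t *\<^sub>R y + c))
      \<le> (1 - t) * ln (inverse (x + c)) + t * ln (inverse (y + c))"
    using xy t assms by (simp add: ln_inverse add_pos_nonneg add_pos_pos)
qed (use assms in auto)

text \<open>
  A difference of log-convex functions need not be log-convex. Here the two functions
  \<open>a = 1 / (x + c)\<close> and \<open>b = 1 / (x + c + 1)\<close> satisfy \<open>a - b = a * b\<close>, and this turns the factorisation
  of \<open>a^(m+1) - b^(m+1)\<close> into an expression without subtraction.
\<close>
lemma log_convex_on_inverse_power_diff:
  assumes "c \<ge> (0::real)"
  shows "log_convex_on {0<..}
    (\<lambda>x. inverse (x + c) ^ Suc m - inverse (x + (c + 1)) ^ Suc m)"
proof -
  let ?a = "\<lambda>x. inverse (x + c)" and ?b = "\<lambda>x. inverse (x + (c + 1))"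
  have "log_convex_on {0<..} (\<lambda>x. ?a x * ?b x * (\<Sum>i<Suc m. ?a x ^ i * ?b x ^ (m - i)))"
    using assms
    by (intro log_convex_on_mult log_convex_on_sum log_convex_on_power log_convex_on_inverse_shift)
      auto
  moreover have "?a x * ?b x * (\<Sum>i<Suc m. ?a x ^ i * ?b x ^ (m - i))
      = ?a x ^ Suc m - ?b x ^ Suc m" if "x \<in> {0<..}" for x
  proof -
    have "?a x - ?b x = ?a x * ?b x" using that assms by (simp add: divide_simps)
    moreover have "?a x ^ Suc m - ?b x ^ Suc m
        = (?a x - ?b x) * (\<Sum>i<Suc m. ?a x ^ i * ?b x ^ (m - i))"
      by (rule diff_power_eq_sum)
    ultimately show ?thesis by simp
  qed
  ultimately show ?thesis
    by (rule log_convex_on_cong[THEN iffD1, rotated])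
qed

section \<open>The functional equation\<close>

text \<open>
  Applying the equation at \<open>x + 2n\<close> and \<open>x + 2n + 1\<close> shows that the series telescopes, with partial
  sums \<open>f x - f (x + 2n)\<close>. Nonnegativity gives \<open>f \<le> g\<close>, which makes the remainder vanish.
\<close>
lemma alternating_series_of_functional_equation:
  fixes f g :: "real \<Rightarrow> real"
  assumes nonneg: "\<And>x. x > 0 \<Longrightarrow> 0 \<le> f x"
    and eq: "\<And>x. x > 0 \<Longrightarrow> f x + f (x + 1) = g x"
    and g: "(g \<longlongrightarrow> 0) at_top" and "x > 0"
  shows "(\<lambda>n. g (x + 2 * real n) - g (x + (2 * real n + 1))) sums f x"
proof -
  have "(f \<longlongrightarrow> 0) at_top"
  proof (rule tendsto_sandwich[OF _ _ tendsto_const g])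
    show "\<forall>\<^sub>F y in at_top. 0 \<le> f y"
      using eventually_gt_at_top[of "0::real"] by eventually_elim (rule nonneg)
    show "\<forall>\<^sub>F y in at_top. f y \<le> g y"
      using eventually_gt_at_top[of "0::real"]
    proof eventually_elim
      fix y :: real assume "0 < y"
      then show "f y \<le> g y" using eq[of y] nonneg[of "y + 1"] by simp
    qed
  qed
  moreover have "filterlim (\<lambda>n. x + 2 * real n) at_top sequentially"
    by (intro filterlim_tendsto_add_at_top[OF tendsto_const]
        filterlim_tendsto_pos_mult_at_top[OF tendsto_const] filterlim_real_sequentially) auto
  ultimately have "(\<lambda>n. f (x + 2 * real n)) \<longlonglongrightarrow> 0" by (rule filterlim_compose)
  then have "(\<lambda>n. f (x + 2 * real n) - f (x + 2 * real (Suc n))) sums (f (x + 2 * real 0) - 0)"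
    by (rule telescope_sums')
  moreover have "f (x + 2 * real n) - f (x + 2 * real (Suc n))
      = g (x + 2 * real n) - g (x + (2 * real n + 1))" for n
    using eq[of "x + 2 * real n"] eq[of "x + 2 * real n + 1"] \<open>x > 0\<close> by (simp add: algebra_simps)
  ultimately show ?thesis by simp
qed

lemma tendsto_inverse_power_at_top:
  "((\<lambda>x::real. c * inverse x ^ Suc m) \<longlongrightarrow> 0) at_top"
  by (intro tendsto_mult_right_zero tendsto_null_power tendsto_inverse_0_at_top filterlim_ident) auto

lemma nielsen_beta_integrable:
  assumes "x > 0"
  shows "(\<lambda>t::real. t powr (x - 1) / (1 + t)) integrable_on {0..1}"
proof (rule measurable_bounded_by_integrable_imp_integrable)
  show "(\<lambda>t::real. t powr (x - 1)) integrable_on {0..1}"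
    using has_integral_powr_from_0[of "x - 1" 1] assms by (auto simp: integrable_on_def)
  show "(\<lambda>t::real. t powr (x - 1) / (1 + t)) \<in> borel_measurable (lebesgue_on {0..1})"
    by (intro measurable_restrict_space1 measurable_completion) measurable
  show "norm (t powr (x - 1) / (1 + t)) \<le> t powr (x - 1)" if "t \<in> {0..1}" for t
    using that by (simp add: divide_le_eq mult_left_mono algebra_simps)
qed auto

lemma nielsen_beta_nonneg: "x > 0 \<Longrightarrow> 0 \<le> nielsen_beta x"
  unfolding nielsen_beta_def by (intro integral_nonneg nielsen_beta_integrable) auto

lemma nielsen_beta_functional_equation:
  assumes "x > 0"
  shows "nielsen_beta x + nielsen_beta (x + 1) = 1 / x"
proof -
  have "nielsen_beta x + nielsen_beta (x + 1)
      = integral {0..1} (\<lambda>t. t powr (x - 1) / (1 + t) + t powr (x + 1 - 1) / (1 + t))"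
    unfolding nielsen_beta_def using assms
    by (intro Henstock_Kurzweil_Integration.integral_add[symmetric] nielsen_beta_integrable) auto
  also have "\<dots> = integral {0..1} (\<lambda>t. t powr (x - 1))"
  proof (rule Henstock_Kurzweil_Integration.integral_cong)
    fix t :: real assume t: "t \<in> {0..1}"
    have "t powr (x + 1 - 1) = t powr (x - 1) * t"
      using t by (cases "t = 0") (auto simp: powr_diff)
    then show "t powr (x - 1) / (1 + t) + t powr (x + 1 - 1) / (1 + t) = t powr (x - 1)"
      using t by (simp add: divide_simps) (simp add: algebra_simps)
  qed
  also have "\<dots> = 1 / x"
    using has_integral_powr_from_0[of "x - 1" 1] assms by (simp add: integral_unique)
  finally show ?thesis .
qed

section \<open>The derivatives of Nielsen's function\<close>

text \<open>
  The \<open>m\<close>-th derivative of half of \<open>Digamma ((x + 1) / 2) - Digamma (x / 2)\<close>; each differentiation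
  contributes another factor \<open>1 / 2\<close>.
\<close>
definition polygamma_diff :: "nat \<Rightarrow> real \<Rightarrow> real" where
  "polygamma_diff m x = (1 / 2) ^ Suc m * (Polygamma m (x / 2 + 1 / 2) - Polygamma m (x / 2))"

lemma not_nonpos_Ints: "x > (0::real) \<Longrightarrow> x \<notin> \<int>\<^sub>\<le>\<^sub>0"
  by (auto elim!: nonpos_Ints_cases)

text \<open>
  Adding the values at \<open>x\<close> and \<open>x + 1\<close> cancels the middle term and leaves arguments that differ by
  \<open>1\<close>, where the recurrence of the polygamma functions applies.
\<close>
lemma polygamma_diff_functional_equation:
  assumes "even m" "x > 0"
  shows "polygamma_diff m x + polygamma_diff m (x + 1) = fact m * inverse x ^ Suc m"
proof -
  have "polygamma_diff m x + polygamma_diff m (x + 1)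
      = (1 / 2) ^ Suc m * (Polygamma m (x / 2 + 1) - Polygamma m (x / 2))"
    by (simp add: polygamma_diff_def algebra_simps add_divide_distrib)
  also have "\<dots> = (1 / 2) ^ Suc m * (fact m / (x / 2) ^ Suc m)"
    using assms by (subst Polygamma_plus1) auto
  also have "\<dots> = fact m * inverse x ^ Suc m"
    by (simp add: field_simps power_divide)
  finally show ?thesis .
qed

text \<open>
  For even \<open>m\<close> the polygamma function of order \<open>m\<close> is increasing on the positive reals, which makes the
  difference nonnegative.
\<close>
lemma polygamma_diff_sums:
  assumes "even m" "x > 0"
  shows "(\<lambda>n. fact m * inverse (x + 2 * real n) ^ Suc m
    - fact m * inverse (x + (2 * real n + 1)) ^ Suc m) sums polygamma_diff m x"
  using assms
  by (intro alternating_series_of_functional_equation polygamma_diff_functional_equation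
      tendsto_inverse_power_at_top)
    (auto simp: polygamma_diff_def intro!: mult_nonneg_nonneg Polygamma_real_mono)

text \<open>
  Both sides are nonnegative and satisfy the functional equation with \<open>g x = 1 / x\<close>, so they are sums
  of the same series.
\<close>
lemma nielsen_beta_eq_polygamma_diff:
  assumes "x > 0"
  shows "nielsen_beta x = polygamma_diff 0 x"
proof (rule sums_unique2)
  show "(\<lambda>n. fact 0 * inverse (x + 2 * real n) ^ Suc 0
    - fact 0 * inverse (x + (2 * real n + 1)) ^ Suc 0) sums polygamma_diff 0 x"
    using assms by (intro polygamma_diff_sums) auto
  show "(\<lambda>n. fact 0 * inverse (x + 2 * real n) ^ Suc 0
    - fact 0 * inverse (x + (2 * real n + 1)) ^ Suc 0) sums nielsen_beta x"
    using assms
    by (intro alternating_series_of_functional_equation[where f = nielsen_beta]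
        tendsto_inverse_power_at_top nielsen_beta_nonneg)
      (auto simp: nielsen_beta_functional_equation inverse_eq_divide)
qed

lemma polygamma_diff_has_derivative:
  assumes "x > 0"
  shows "(polygamma_diff m has_field_derivative polygamma_diff (Suc m) x) (at x)"
proof -
  have "((\<lambda>x. (1 / 2) ^ Suc m * (Polygamma m (x / 2 + 1 / 2) - Polygamma m (x / 2)))
      has_field_derivative polygamma_diff (Suc m) x) (at x)"
    using assms
    by (auto intro!: derivative_eq_intros not_nonpos_Ints simp: polygamma_diff_def algebra_simps)
  then show ?thesis unfolding polygamma_diff_def[abs_def] .
qed

lemma higher_deriv_nielsen_beta:
  "x > 0 \<Longrightarrow> (deriv ^^ m) nielsen_beta x = polygamma_diff m x"
proof (induction m arbitrary: x)
  case 0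
  then show ?case by (simp add: nielsen_beta_eq_polygamma_diff)
next
  case (Suc m)
  have "((deriv ^^ m) nielsen_beta has_field_derivative polygamma_diff (Suc m) x) (at x)"
    by (rule has_field_derivative_transform_within_open
        [OF polygamma_diff_has_derivative[OF Suc.prems], of "{0<..}"])
      (use Suc in auto)
  then show ?case by (simp add: DERIV_imp_deriv)
qed

lemma log_convex_on_polygamma_diff:
  assumes "even m"
  shows "log_convex_on {0<..} (polygamma_diff m)"
proof (rule log_convex_on_suminf)
  show "log_convex_on {0<..} (\<lambda>x. fact m * (inverse (x + 2 * real n) ^ Suc m
      - inverse (x + (2 * real n + 1)) ^ Suc m))" for n
    by (intro log_convex_on_mult log_convex_on_const log_convex_on_inverse_power_diff) auto
  show "(\<lambda>n. fact m * (inverse (x + 2 * real n) ^ Suc m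
      - inverse (x + (2 * real n + 1)) ^ Suc m)) sums polygamma_diff m x" if "x \<in> {0<..}" for x
    using polygamma_diff_sums[OF assms, of x] that by (simp only: right_diff_distrib) auto
qed

theorem theorem2p12:
  fixes m :: nat and \<alpha> :: real
  assumes "even m" and "\<alpha> > 0"
  shows "convex_on {0<..} (\<lambda>x. ((deriv ^^ m) nielsen_beta x) powr \<alpha>)"
proof -
  have "convex_on {0<..} (\<lambda>x. polygamma_diff m x powr \<alpha>)"
    using assms by (intro log_convex_on_powr_convex log_convex_on_polygamma_diff) auto
  then show ?thesis
    by (subst convex_on_cong[of "{0<..}" _ "\<lambda>x. polygamma_diff m x powr \<alpha>"])
      (auto simp: higher_deriv_nielsen_beta)
qed

end
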